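(* Let $(\Omega,\mathcal F,(\mathcal F_n)_{n\in\mathbb N})$ be a discrete-time filtered space with $\mathcal F=\bigvee_n\mathcal F_n$, and let $\mu,\nu$ be probability measures on it. For $\alpha\in(0,1)$ put $$H(\alpha;\mu_n,\nu_n)=\int\Big(\frac{d\mu_n}{d\nu_n}\Big)^{\alpha}d\nu_n .$$ Then $$\|\mu_a\|=\liminf_{n\to\infty,\ \alpha\to1-0}H(\alpha;\mu_n,\nu_n),$$ where $\mu_a$ is the absolutely continuous part of $\mu$ with respect to $\nu$.
   Context: $\mu_n,\nu_n$ are the restrictions of $\mu,\nu$ to $\mathcal F_n$. For measures not assumed absolutely continuous, $\frac{d\mu_n}{d\nu_n}$ denotes the density with respect to $\nu_n$ of the absolutely continuous part of $\mu_n$ with respect to $\nu_n$ in the Lebesgue decomposition. $\|\cdot\|$ is the total variation norm. The double lower limit is defined by $$\liminf_{n\to\infty,\ \alpha\to1-0}f(\alpha,n)=\sup_{n\in\mathbb N,\ \beta\in(0,1)}\ \inf_{m\ge n,\ x\in[\beta,1)}f(x,m).$$ *)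

theory Defs
  imports "HOL-Probability.Probability"
begin

definition mutually_singular :: "'a measure \<Rightarrow> 'a measure \<Rightarrow> bool" where
  "mutually_singular M N \<longleftrightarrow>
     sets M = sets N \<and> (\<exists>A\<in>sets M. emeasure M A = 0 \<and> emeasure N (space M - A) = 0)"

text \<open>As in \<^const>\<open>absolutely_continuous\<close> and \<^const>\<open>RN_deriv\<close>, the reference measure comes
  first: \<open>N = Na + Ns\<close> with \<open>Na\<close> absolutely continuous and \<open>Ns\<close> singular with respect to \<open>M\<close>.\<close>

definition lebesgue_decomposition :: "'a measure \<Rightarrow> 'a measure \<Rightarrow> 'a measure \<Rightarrow> 'a measure \<Rightarrow> bool" where
  "lebesgue_decomposition M N Na Ns \<longleftrightarrow>
     sets Na = sets N \<and> sets Ns = sets N \<and>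
     (\<forall>A\<in>sets N. emeasure N A = emeasure Na A + emeasure Ns A) \<and>
     absolutely_continuous M Na \<and> mutually_singular M Ns"

definition ac_part :: "'a measure \<Rightarrow> 'a measure \<Rightarrow> 'a measure" where
  "ac_part M N = (THE Na. \<exists>Ns. lebesgue_decomposition M N Na Ns)"

definition ac_density :: "'a measure \<Rightarrow> 'a measure \<Rightarrow> 'a \<Rightarrow> ennreal" where
  "ac_density M N = RN_deriv M (ac_part M N)"

text \<open>Only the \<open>\<sigma>\<close>-algebra of \<open>M\<close> is used; \<open>m\<close> is a real-valued set function on it.\<close>

definition total_variation_norm :: "'a measure \<Rightarrow> ('a set \<Rightarrow> real) \<Rightarrow> ennreal" where
  "total_variation_norm M m =
     (SUP P\<in>{P. finite P \<and> P \<subseteq> sets M \<and> disjoint P \<and> \<Union>P = space M}. \<Sum>A\<in>P. ennreal \<bar>m A\<bar>)"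

text \<open>The density is finite almost everywhere when \<open>N\<close> is a finite measure, so passing through
  \<^const>\<open>enn2real\<close> (which sends \<open>\<infinity>\<close> to \<open>0\<close>) does not affect the integral.\<close>

definition hellinger_integral :: "real \<Rightarrow> 'a measure \<Rightarrow> 'a measure \<Rightarrow> ennreal" where
  "hellinger_integral \<alpha> N M = (\<integral>\<^sup>+x. ennreal (enn2real (ac_density M N x) powr \<alpha>) \<partial>M)"

definition double_liminf :: "(real \<Rightarrow> nat \<Rightarrow> 'b::complete_lattice) \<Rightarrow> 'b" where
  "double_liminf f =
     (SUP (n, \<beta>)\<in>UNIV \<times> {0<..<1}. INF (m, x)\<in>{n..} \<times> {\<beta>..<1}. f x m)"

lemma lebesgue_decomposition_exists:
  assumes "finite_measure N" and sets_eq: "sets M = sets N"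
  shows "\<exists>Na Ns. lebesgue_decomposition M N Na Ns"
proof -
  interpret finite_measure N by fact
  have ne: "null_sets M \<noteq> {}" by auto
  from ennreal_SUP_countable_SUP[OF ne, of "emeasure N"]
  obtain f :: "nat \<Rightarrow> ennreal" where f: "range f \<subseteq> emeasure N ` null_sets M"
    "(SUP A\<in>null_sets M. emeasure N A) = (SUP i. f i)" by auto
  then have "\<forall>i. \<exists>A\<in>null_sets M. f i = emeasure N A" by auto
  then obtain B where B: "\<And>i. B i \<in> null_sets M" "\<And>i. f i = emeasure N (B i)" by metis
  define S where "S = (\<Union>i. B i)"
  have S: "S \<in> null_sets M" unfolding S_def using B by auto
  then have S_sets[measurable]: "S \<in> sets N" using sets_eq by auto
  have upper: "emeasure N A \<le> emeasure N S" if "A \<in> null_sets M" for A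
  proof -
    have "emeasure N A \<le> (SUP i. f i)" unfolding f(2)[symmetric] using that by (rule SUP_upper)
    also have "\<dots> \<le> emeasure N S"
    proof (rule SUP_least)
      fix i
      have "B i \<subseteq> S" by (auto simp: S_def)
      then show "f i \<le> emeasure N S" unfolding B(2) using S_sets by (rule emeasure_mono)
    qed
    finally show ?thesis .
  qed
  have rest: "emeasure N (A - S) = 0" if A: "A \<in> null_sets M" for A
  proof -
    have [measurable]: "A \<in> sets N" using A sets_eq by auto
    have "emeasure N S + emeasure N (A - S) = emeasure N (S \<union> (A - S))"
      by (intro plus_emeasure) auto
    also have "S \<union> (A - S) = S \<union> A" by auto
    also have "emeasure N (S \<union> A) \<le> emeasure N S"
      using upper[of "S \<union> A"] A S by auto
    finally have "emeasure N S + emeasure N (A - S) \<le> emeasure N S + 0" by simp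
    then show ?thesis
      by (subst (asm) ennreal_add_left_cancel_le) (auto simp: emeasure_finite)
  qed
  define Na where "Na = density N (indicator (space N - S))"
  define Ns where "Ns = density N (indicator S)"
  have space_eq: "space M = space N" using sets_eq by (rule sets_eq_imp_space_eq)
  have Na: "emeasure Na A = emeasure N (A - S)" if "A \<in> sets N" for A
  proof -
    have "(space N - S) \<inter> A = A - S" using sets.sets_into_space[OF that] by auto
    then show ?thesis using that unfolding Na_def by (subst emeasure_restricted) auto
  qed
  have Ns: "emeasure Ns A = emeasure N (S \<inter> A)" if "A \<in> sets N" for A
    using that unfolding Ns_def by (subst emeasure_restricted) auto
  have sum: "emeasure N A = emeasure Na A + emeasure Ns A" if A: "A \<in> sets N" for A
  proof -
    have "emeasure Na A + emeasure Ns A = emeasure N ((A - S) \<union> (S \<inter> A))"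
      unfolding Na[OF A] Ns[OF A] using A by (intro plus_emeasure) auto
    also have "(A - S) \<union> (S \<inter> A) = A" by auto
    finally show ?thesis by simp
  qed
  have "lebesgue_decomposition M N Na Ns"
    unfolding lebesgue_decomposition_def
  proof (intro conjI ballI sum)
    show "sets Na = sets N" "sets Ns = sets N" by (simp_all add: Na_def Ns_def)
    show "absolutely_continuous M Na"
      unfolding absolutely_continuous_def
    proof
      fix A assume A: "A \<in> null_sets M"
      then have "A \<in> sets N" using sets_eq by auto
      then show "A \<in> null_sets Na" using rest[OF A] Na by (auto simp: null_sets_def Na_def)
    qed
    have "emeasure Ns (space M - S) = 0"
      by (subst Ns) (auto simp: space_eq)
    then show "mutually_singular M Ns"
      unfolding mutually_singular_def using S sets_eq
      by (intro conjI bexI[of _ S]) (simp_all add: Ns_def null_sets_def)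
  qed
  then show ?thesis by blast
qed

lemma lebesgue_decompositionD:
  assumes "lebesgue_decomposition M N Na Ns"
  shows "sets Na = sets N" "sets Ns = sets N"
    "\<And>A. A \<in> sets N \<Longrightarrow> emeasure N A = emeasure Na A + emeasure Ns A"
    "absolutely_continuous M Na" "sets M = sets N"
    "\<exists>A\<in>sets N. emeasure M A = 0 \<and> emeasure Ns (space M - A) = 0"
proof -
  have D: "sets Na = sets N" "sets Ns = sets N" "sets M = sets Ns" "absolutely_continuous M Na"
    "\<forall>A\<in>sets N. emeasure N A = emeasure Na A + emeasure Ns A"
    "\<exists>A\<in>sets M. emeasure M A = 0 \<and> emeasure Ns (space M - A) = 0"
    using assms unfolding lebesgue_decomposition_def mutually_singular_def
    by - (elim conjE, assumption)+
  show "sets Na = sets N" "sets Ns = sets N" "absolutely_continuous M Na" by (rule D)+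
  show M: "sets M = sets N" using D(3,2) by (rule trans)
  show "emeasure N A = emeasure Na A + emeasure Ns A" if "A \<in> sets N" for A
    using D(5) that by (rule bspec)
  show "\<exists>A\<in>sets N. emeasure M A = 0 \<and> emeasure Ns (space M - A) = 0"
    using D(6) unfolding M .
qed

lemma lebesgue_decomposition_emeasure:
  assumes dec: "lebesgue_decomposition M N Na Ns"
    and dec': "lebesgue_decomposition M N Na' Ns'" and A: "A \<in> sets N"
  shows "emeasure Na A \<le> emeasure Na' A"
proof -
  note D = lebesgue_decompositionD[OF dec] and D' = lebesgue_decompositionD[OF dec']
  note sets_Na = D(1) and sets_Na' = D'(1) and sets_Ns' = D'(2) and sets_M = D'(5)
  obtain T where TN: "T \<in> sets N" and T0: "emeasure M T = 0" "emeasure Ns' (space M - T) = 0"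
    using D'(6) by (elim bexE conjE)
  have TM: "T \<in> sets M" using TN unfolding sets_M .
  have space_M: "space M = space N" using sets_M by (rule sets_eq_imp_space_eq)
  have AT: "A - T \<in> sets N" "A \<inter> T \<in> sets N" using A TN by (rule sets.Diff sets.Int)+
  have "emeasure M (A \<inter> T) = 0" by (rule emeasure_eq_0[OF TM T0(1)]) blast
  then have "A \<inter> T \<in> null_sets M" using AT(2) unfolding sets_M[symmetric] by (rule null_setsI)
  then have "A \<inter> T \<in> null_sets Na" using D(4) unfolding absolutely_continuous_def by (rule rev_subsetD)
  then have 0: "emeasure Na (A \<inter> T) = 0" by (rule null_setsD1)
  have compl: "space M - T \<in> sets Ns'"
    unfolding sets_Ns' space_M using TN by (rule sets.compl_sets)
  have 1: "emeasure Ns' (A - T) = 0"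
  proof (rule emeasure_eq_0[OF compl T0(2)])
    show "A - T \<subseteq> space M - T"
      unfolding space_M using sets.sets_into_space[OF A] by (rule Diff_mono) simp
  qed
  have "emeasure Na A = emeasure Na ((A - T) \<union> (A \<inter> T))" by (rule arg_cong[where f = "emeasure Na"]) blast
  also have "\<dots> = emeasure Na (A - T) + emeasure Na (A \<inter> T)"
    using AT unfolding sets_Na[symmetric] by (rule plus_emeasure[symmetric]) blast
  also have "\<dots> = emeasure Na (A - T)" unfolding 0 by simp
  also have "\<dots> \<le> emeasure Na (A - T) + emeasure Ns (A - T)" by simp
  also have "\<dots> = emeasure N (A - T)" using D(3)[OF AT(1)] by (rule sym)
  also have "\<dots> = emeasure Na' (A - T) + emeasure Ns' (A - T)" using AT(1) by (rule D'(3))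
  also have "\<dots> = emeasure Na' (A - T)" unfolding 1 by simp
  also have "\<dots> \<le> emeasure Na' A" using A by (intro emeasure_mono) (simp_all add: sets_Na')
  finally show ?thesis .
qed

lemma lebesgue_decomposition_ac_part:
  assumes "finite_measure N" "sets M = sets N"
  shows "\<exists>Ns. lebesgue_decomposition M N (ac_part M N) Ns"
  unfolding ac_part_def
proof (rule theI')
  show "\<exists>!Na. \<exists>Ns. lebesgue_decomposition M N Na Ns"
  proof (rule ex_ex1I)
    show "\<exists>Na Ns. lebesgue_decomposition M N Na Ns"
      by (rule lebesgue_decomposition_exists) fact+
  next
    fix Na Na'
    assume "\<exists>Ns. lebesgue_decomposition M N Na Ns" "\<exists>Ns. lebesgue_decomposition M N Na' Ns"
    then obtain Ns Ns' where d: "lebesgue_decomposition M N Na Ns"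
      "lebesgue_decomposition M N Na' Ns'" by blast
    show "Na = Na'"
    proof (rule measure_eqI)
      show s: "sets Na = sets Na'" using d by (simp add: lebesgue_decomposition_def)
      fix A assume "A \<in> sets Na"
      then have "A \<in> sets N" using d by (simp add: lebesgue_decomposition_def)
      then show "emeasure Na A = emeasure Na' A"
        using lebesgue_decomposition_emeasure[OF d]
          lebesgue_decomposition_emeasure[OF d(2) d(1)] by (intro order_antisym)
    qed
  qed
qed

end

theory Submission
  imports Defs
begin

text \<open>Let \<open>S\<close> be \<open>\<nu>\<close>-null and carry the singular part of \<open>\<mu>\<close>. Everything rests on the tangent
  inequality \<open>w\<^sup>\<alpha> \<le> \<alpha> w t\<^sup>\<alpha>\<^sup>-\<^sup>1 + (1 - \<alpha>) t\<^sup>\<alpha>\<close>.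
  With \<open>w = d\<mu>\<^sub>a/d\<nu>\<close> and \<open>t = d\<mu>\<^sub>n/d\<nu>\<^sub>n\<close> it gives \<open>H(\<alpha>; \<mu>, \<nu>) \<le> H(\<alpha>; \<mu>\<^sub>n, \<nu>\<^sub>n)\<close>, and
  \<open>H(\<alpha>; \<mu>, \<nu>)\<close> tends to \<open>\<parallel>\<mu>\<^sub>a\<parallel>\<close> as \<open>\<alpha>\<close> tends to 1 by monotone convergence; this bounds
  the lower limit from below. For the upper bound, approximate \<open>S\<close> by a set \<open>A\<close> in some \<open>\<F>\<^sub>n\<close> and use the inequality with
  \<open>w = d\<mu>\<^sub>n/d\<nu>\<^sub>n\<close>, with \<open>t = 1\<close> off \<open>A\<close> and \<open>t\<close> a large constant on \<open>A\<close>.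
  No martingale convergence is needed.\<close>

section \<open>Tangent lines to concave powers\<close>

text \<open>Weighted AM-GM for \<open>u = w / t\<close> and 1 with weights \<open>x\<close> and
  \<open>1 - x\<close>, multiplied by \<open>t powr x\<close>. The bound is affine in
  \<open>w\<close>, hence integrable by knowing \<open>w\<close> only through its integrals, and it
  is sharp at \<open>w = t\<close>.\<close>

lemma powr_le_tangent:
  fixes w t x :: real
  assumes "0 \<le> w" "0 < t" "0 < x" "x < 1"
  shows "w powr x \<le> x * t powr (x - 1) * w + (1 - x) * t powr x"
proof (cases "w = 0")
  case False
  then have w: "0 < w" using assms by simp
  define u where "u = w / t"
  have u: "0 < u" using w assms by (simp add: u_def)
  have "u powr x * 1 powr (1 - x) \<le> x * u + (1 - x) * 1"
    using u assms by (intro Youngs_inequality_0) auto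
  then have "u powr x * t powr x \<le> (x * u + (1 - x)) * t powr x"
    by (intro mult_right_mono) auto
  moreover have "u powr x * t powr x = w powr x"
    using w assms by (simp add: u_def powr_divide)
  moreover have "(x * u + (1 - x)) * t powr x = x * t powr (x - 1) * w + (1 - x) * t powr x"
    using assms by (simp add: u_def powr_diff algebra_simps)
  ultimately show ?thesis by simp
qed (use assms in simp)

section \<open>Absolutely continuous parts and their densities\<close>

text \<open>The absolutely continuous part inherits finiteness from \<open>N\<close>, so its density
  is finite almost everywhere and sending infinity to 0 alters it only on a null set. All later
  arguments can thus use a real-valued density.\<close>

lemma ac_part_density:
  assumes "finite_measure M" "finite_measure N" "sets M = sets N"
  shows "ac_part M N = density M (\<lambda>x. ennreal (enn2real (ac_density M N x)))"
proof -
  interpret M: finite_measure M by fact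
  interpret N: finite_measure N by fact
  obtain Ns where "lebesgue_decomposition M N (ac_part M N) Ns"
    using lebesgue_decomposition_ac_part assms by blast
  note D = lebesgue_decompositionD[OF this]
  have dens: "density M (ac_density M N) = ac_part M N"
    unfolding ac_density_def using D(4) D(1) assms(3) by (intro M.density_RN_deriv) auto
  have "emeasure (ac_part M N) (space N) \<noteq> \<infinity>"
    using D(3)[of "space N"] N.emeasure_finite[of "space N"] by auto
  then have "finite_measure (ac_part M N)"
    using sets_eq_imp_space_eq[OF D(1)] by (intro finite_measureI) simp
  then have "AE x in M. ac_density M N x \<noteq> \<infinity>"
    unfolding ac_density_def using D(1,4) assms(3)
    by (intro M.RN_deriv_finite) (auto intro: finite_measure.axioms)
  then have "density M (ac_density M N) = density M (\<lambda>x. ennreal (enn2real (ac_density M N x)))"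
    by (intro density_cong) (auto simp: ac_density_def less_top)
  then show ?thesis using dens by simp
qed

lemma borel_measurable_ac_density[measurable]: "ac_density M N \<in> borel_measurable M"
  by (simp add: ac_density_def)

lemma ac_part_le:
  assumes "finite_measure N" "sets M = sets N" "A \<in> sets N"
  shows "emeasure (ac_part M N) A \<le> emeasure N A"
proof -
  obtain Ns where "lebesgue_decomposition M N (ac_part M N) Ns"
    using lebesgue_decomposition_ac_part assms by blast
  from lebesgue_decompositionD(3)[OF this assms(3)] show ?thesis by simp
qed

text \<open>The set witnessing singularity carries all of the singular part; once it is removed,
  only the absolutely continuous part is left.\<close>

lemma ac_part_carrier:
  assumes "finite_measure N" "sets M = sets N"
  obtains S where "S \<in> null_sets M"
    "\<And>A. A \<in> sets N \<Longrightarrow> emeasure N (A - S) = emeasure (ac_part M N) (A - S)"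
proof -
  obtain Ns where "lebesgue_decomposition M N (ac_part M N) Ns"
    using lebesgue_decomposition_ac_part assms by blast
  note D = lebesgue_decompositionD[OF this]
  from D(6) obtain S where S: "S \<in> sets N" "emeasure M S = 0" "emeasure Ns (space M - S) = 0"
    by blast
  have sp: "space M = space N" using assms(2) by (rule sets_eq_imp_space_eq)
  show thesis
  proof (rule that)
    show "S \<in> null_sets M" using S assms by (auto simp: null_sets_def)
    fix A assume A: "A \<in> sets N"
    have "emeasure Ns (A - S) = 0"
      using S A sets.sets_into_space[OF A]
      by (intro emeasure_eq_0[OF _ S(3)]) (auto simp: D(2) sp)
    then show "emeasure N (A - S) = emeasure (ac_part M N) (A - S)"
      using D(3)[of "A - S"] A S by auto
  qed
qed

text \<open>\<open>K\<close> does not charge the null set \<open>S\<close> carrying the singular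
  part, and off \<open>S\<close> the measure \<open>N\<close> coincides with its absolutely
  continuous part. This maximality takes the place of conditional expectations when densities on two
  \<sigma>-algebras are compared.\<close>

lemma ac_part_greatest:
  assumes "finite_measure N" "sets M = sets N" "sets K = sets N" "absolutely_continuous M K"
    and le: "\<And>A. A \<in> sets N \<Longrightarrow> emeasure K A \<le> emeasure N A" and A: "A \<in> sets N"
  shows "emeasure K A \<le> emeasure (ac_part M N) A"
proof -
  obtain S where S: "S \<in> null_sets M"
    "\<And>A. A \<in> sets N \<Longrightarrow> emeasure N (A - S) = emeasure (ac_part M N) (A - S)"
    using ac_part_carrier assms(1,2) by blast
  have SN: "S \<in> sets N" using S(1) assms(2) by auto
  have sets_ac: "sets (ac_part M N) = sets N"
    using lebesgue_decomposition_ac_part[OF assms(1,2)] lebesgue_decompositionD(1) by blast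
  have "S \<in> null_sets K" using S(1) assms(4) by (auto simp: absolutely_continuous_def)
  then have "emeasure K A = emeasure K (A - S)"
    using A assms(3) by (simp add: emeasure_Diff_null_set)
  also have "\<dots> \<le> emeasure N (A - S)" using A SN by (intro le) auto
  also have "\<dots> \<le> emeasure (ac_part M N) A"
    unfolding S(2)[OF A] using A by (intro emeasure_mono) (auto simp: sets_ac)
  finally show ?thesis .
qed

section \<open>Total variation of a positive measure\<close>

text \<open>By additivity every finite partition yields the same sum, so the supremum runs over a
  single value.\<close>

lemma total_variation_norm_measure:
  assumes "finite_measure N" "sets M = sets N"
  shows "total_variation_norm M (measure N) = emeasure N (space M)"
proof -
  interpret finite_measure N by fact
  have sum: "(\<Sum>A\<in>P. ennreal \<bar>measure N A\<bar>) = emeasure N (space M)"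
    if "finite P" "P \<subseteq> sets M" "disjoint P" "\<Union>P = space M" for P
  proof -
    have "(\<Sum>A\<in>P. ennreal \<bar>measure N A\<bar>) = (\<Sum>A\<in>P. emeasure N A)"
      by (simp add: emeasure_eq_measure)
    also have "\<dots> = emeasure N (\<Union>A\<in>P. A)"
      using that assms(2) by (intro sum_emeasure) (auto simp: disjoint_family_on_def disjoint_def)
    finally show ?thesis using that(4) by simp
  qed
  show ?thesis unfolding total_variation_norm_def
  proof (rule antisym)
    show "(SUP P\<in>{P. finite P \<and> P \<subseteq> sets M \<and> disjoint P \<and> \<Union>P = space M}. \<Sum>A\<in>P. ennreal \<bar>measure N A\<bar>)
      \<le> emeasure N (space M)"
      by (rule SUP_least) (simp only: sum mem_Collect_eq order_refl)
    show "emeasure N (space M) \<le>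
      (SUP P\<in>{P. finite P \<and> P \<subseteq> sets M \<and> disjoint P \<and> \<Union>P = space M}. \<Sum>A\<in>P. ennreal \<bar>measure N A\<bar>)"
      by (rule SUP_upper2[where i = "{space M}"]) (auto simp: sum emeasure_eq_measure[symmetric])
  qed
qed

section \<open>Hellinger integrals under restriction to a subalgebra\<close>

text \<open>The tangent inequality is applied to the fine density \<open>z\<close> at the point
  \<open>t = w\<close>, the coarse density. Its coefficients are \<open>G\<close>-measurable, so
  \<open>z\<close> may be exchanged for \<open>w\<close> under the integral, and at \<open>w\<close>
  itself the inequality is an equality.\<close>

lemma hellinger_integral_restr_ge:
  assumes "finite_measure \<mu>" "finite_measure \<nu>" and sets_eq: "sets \<nu> = sets \<mu>"
    and sub: "subalgebra \<nu> G" and x: "0 < x" "x < 1"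
  shows "hellinger_integral x \<mu> \<nu> \<le> hellinger_integral x (restr_to_subalg \<mu> G) (restr_to_subalg \<nu> G)"
proof -
  define M where "M = restr_to_subalg \<nu> G"
  define N where "N = restr_to_subalg \<mu> G"
  define z where "z = (\<lambda>\<omega>. enn2real (ac_density \<nu> \<mu> \<omega>))"
  define w where "w = (\<lambda>\<omega>. enn2real (ac_density M N \<omega>))"
  have sub\<mu>: "subalgebra \<mu> G"
    using sub sets_eq sets_eq_imp_space_eq[OF sets_eq] by (simp add: subalgebra_def)
  have fin: "finite_measure M" "finite_measure N"
    unfolding M_def N_def using assms sub sub\<mu> by (auto intro: finite_measure_restr_to_subalg)
  have setsM: "sets M = sets G" and setsN: "sets N = sets G"
    unfolding M_def N_def using sub sub\<mu> by (simp_all add: sets_restr_to_subalg)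
  have z[measurable]: "z \<in> borel_measurable \<nu>" and z0: "\<And>\<omega>. 0 \<le> z \<omega>" by (simp_all add: z_def)
  have "w \<in> borel_measurable M" by (simp add: w_def)
  then have w[measurable]: "w \<in> borel_measurable G"
    by (simp add: measurable_cong_sets[OF setsM refl])
  have w0: "\<And>\<omega>. 0 \<le> w \<omega>" by (simp add: w_def)
  have GG: "f \<in> borel_measurable G \<Longrightarrow> f \<in> borel_measurable \<nu>" for f :: "'a \<Rightarrow> real"
    using measurable_from_subalg[OF sub] .
  have wn[measurable]: "w \<in> borel_measurable \<nu>" by (rule GG) simp
  have ac\<nu>: "ac_part \<nu> \<mu> = density \<nu> (\<lambda>\<omega>. ennreal (z \<omega>))"
    unfolding z_def using assms by (intro ac_part_density) auto
  have acM: "ac_part M N = density M (\<lambda>\<omega>. ennreal (w \<omega>))"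
    unfolding w_def using fin setsM setsN by (intro ac_part_density) auto
  have subac: "subalgebra (ac_part \<nu> \<mu>) G"
    unfolding ac\<nu> using sub by (simp add: subalgebra_def)
  \<comment> \<open>The absolutely continuous part taken first and restricted afterwards;
    \<open>M\<close> and \<open>N\<close> are restricted first. Maximality shows that the former
    order gives the smaller measure.\<close>
  define K where "K = restr_to_subalg (ac_part \<nu> \<mu>) G"
  have setsK: "sets K = sets G" unfolding K_def using subac by (rule sets_restr_to_subalg)
  have K_le: "emeasure K A \<le> emeasure (ac_part M N) A" if "A \<in> sets G" for A
  proof (rule ac_part_greatest[OF fin(2)])
    show "sets M = sets N" "sets K = sets N" "A \<in> sets N"
      using setsM setsN setsK that by auto
    show "absolutely_continuous M K"
      unfolding absolutely_continuous_def M_def K_def null_sets_restr_to_subalg[OF sub]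
        null_sets_restr_to_subalg[OF subac] unfolding ac\<nu>
      using absolutely_continuousI_density[of "\<lambda>\<omega>. ennreal (z \<omega>)" \<nu>]
      by (auto simp: absolutely_continuous_def)
    fix B assume "B \<in> sets N"
    then have B: "B \<in> sets G" "B \<in> sets \<mu>" using setsN sub\<mu> by (auto simp: subalgebra_def)
    show "emeasure K B \<le> emeasure N B"
      unfolding K_def N_def emeasure_restr_to_subalg[OF subac B(1)]
        emeasure_restr_to_subalg[OF sub\<mu> B(1)]
      using assms B by (intro ac_part_le) auto
  qed
  \<comment> \<open>A tested form of: the conditional expectation of \<open>z\<close> given
    \<open>G\<close> is at most \<open>w\<close>. It can be strict, since singular mass may become
    absolutely continuous on the coarser \<sigma>-algebra.\<close>
  have K_nn_le: "(\<integral>\<^sup>+\<omega>. f \<omega> * ennreal (z \<omega>) \<partial>\<nu>) \<le> (\<integral>\<^sup>+\<omega>. f \<omega> * ennreal (w \<omega>) \<partial>\<nu>)"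
    if f[measurable]: "f \<in> borel_measurable G" for f :: "'a \<Rightarrow> ennreal"
  proof -
    have fn[measurable]: "f \<in> borel_measurable \<nu>" using measurable_from_subalg[OF sub f] .
    have "(\<integral>\<^sup>+\<omega>. f \<omega> * ennreal (z \<omega>) \<partial>\<nu>) = (\<integral>\<^sup>+\<omega>. f \<omega> \<partial>ac_part \<nu> \<mu>)"
      unfolding ac\<nu> by (subst nn_integral_density) (auto simp: mult.commute)
    also have "\<dots> = (\<integral>\<^sup>+\<omega>. f \<omega> \<partial>K)"
      unfolding K_def using subac f by (rule nn_integral_subalgebra2[symmetric])
    also have "\<dots> \<le> (\<integral>\<^sup>+\<omega>. f \<omega> \<partial>ac_part M N)"
    proof (rule nn_integral_mono_measure)
      show s: "sets K = sets (ac_part M N)" unfolding setsK acM by (simp add: setsM)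
      show "K \<le> ac_part M N"
        using sets_eq_imp_space_eq[OF s] s K_le
        by (auto simp: le_measure setsK)
    qed
    also have "\<dots> = (\<integral>\<^sup>+\<omega>. f \<omega> * ennreal (w \<omega>) \<partial>M)"
      unfolding acM using setsM
      by (subst nn_integral_density) (auto simp: mult.commute measurable_cong_sets[OF setsM refl])
    also have "\<dots> = (\<integral>\<^sup>+\<omega>. f \<omega> * ennreal (w \<omega>) \<partial>\<nu>)"
      unfolding M_def by (rule nn_integral_subalgebra2[OF sub]) measurable
    finally show ?thesis .
  qed
  \<comment> \<open>Where \<open>w = 0\<close> the tangent inequality is unavailable, but there \<open>z\<close> vanishes as well.\<close>
  have "(\<integral>\<^sup>+\<omega>. indicator {\<omega>\<in>space G. w \<omega> = 0} \<omega> * ennreal (z \<omega>) \<partial>\<nu>) \<le>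
        (\<integral>\<^sup>+\<omega>. indicator {\<omega>\<in>space G. w \<omega> = 0} \<omega> * ennreal (w \<omega>) \<partial>\<nu>)"
    by (rule K_nn_le) measurable
  also have "\<dots> = (\<integral>\<^sup>+\<omega>. 0 \<partial>\<nu>)" by (intro nn_integral_cong) (auto simp: indicator_def)
  finally have int0: "(\<integral>\<^sup>+\<omega>. indicator {\<omega>\<in>space G. w \<omega> = 0} \<omega> * ennreal (z \<omega>) \<partial>\<nu>) = 0" by simp
  have spG: "space G = space \<nu>" using sub by (simp add: subalgebra_def)
  have "AE \<omega> in \<nu>. indicator {\<omega>\<in>space G. w \<omega> = 0} \<omega> * ennreal (z \<omega>) = 0"
    using int0 by (subst (asm) nn_integral_0_iff_AE) (auto simp: spG)
  with AE_space have AE0: "AE \<omega> in \<nu>. w \<omega> = 0 \<longrightarrow> z \<omega> = 0"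
  proof eventually_elim
    case (elim \<omega>)
    then show ?case
      using z0[of \<omega>] by (auto simp: indicator_def spG)
  qed
  have AE: "AE \<omega> in \<nu>. ennreal (z \<omega> powr x) \<le>
    ennreal (x * w \<omega> powr (x - 1)) * ennreal (z \<omega>) + ennreal ((1 - x) * w \<omega> powr x)"
    using AE0
  proof eventually_elim
    case (elim \<omega>)
    have "z \<omega> powr x \<le> x * w \<omega> powr (x - 1) * z \<omega> + (1 - x) * w \<omega> powr x"
    proof (cases "w \<omega> = 0")
      case True
      then show ?thesis using elim by simp
    next
      case False
      then show ?thesis using z0[of \<omega>] w0[of \<omega>] x by (intro powr_le_tangent) auto
    qed
    then show ?case
      using z0[of \<omega>] w0[of \<omega>] x
      by (simp add: ennreal_mult'[symmetric] ennreal_plus[symmetric] del: ennreal_plus)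
  qed
  have "hellinger_integral x \<mu> \<nu> = (\<integral>\<^sup>+\<omega>. ennreal (z \<omega> powr x) \<partial>\<nu>)"
    by (simp add: hellinger_integral_def z_def)
  also have "\<dots> \<le> (\<integral>\<^sup>+\<omega>. ennreal (x * w \<omega> powr (x - 1)) * ennreal (z \<omega>)
                      + ennreal ((1 - x) * w \<omega> powr x) \<partial>\<nu>)"
    using AE by (rule nn_integral_mono_AE)
  also have "\<dots> = (\<integral>\<^sup>+\<omega>. ennreal (x * w \<omega> powr (x - 1)) * ennreal (z \<omega>) \<partial>\<nu>)
                      + (\<integral>\<^sup>+\<omega>. ennreal ((1 - x) * w \<omega> powr x) \<partial>\<nu>)"
    by (rule nn_integral_add) measurable
  also have "\<dots> \<le> (\<integral>\<^sup>+\<omega>. ennreal (x * w \<omega> powr (x - 1)) * ennreal (w \<omega>) \<partial>\<nu>)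
                      + (\<integral>\<^sup>+\<omega>. ennreal ((1 - x) * w \<omega> powr x) \<partial>\<nu>)"
    by (intro add_right_mono K_nn_le) measurable
  also have "\<dots> = (\<integral>\<^sup>+\<omega>. ennreal (x * w \<omega> powr (x - 1)) * ennreal (w \<omega>)
                      + ennreal ((1 - x) * w \<omega> powr x) \<partial>\<nu>)"
    by (rule nn_integral_add[symmetric]) measurable
  also have "\<dots> = (\<integral>\<^sup>+\<omega>. ennreal (w \<omega> powr x) \<partial>\<nu>)"
  proof (rule nn_integral_cong)
    fix \<omega>
    \<comment> \<open>This survives \<open>w \<omega> = 0\<close> because \<open>powr\<close> with
      base 0 is 0, even for the negative exponent \<open>x - 1\<close>.\<close>
    have "w \<omega> powr (x - 1) * w \<omega> = w \<omega> powr x"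
      using w0[of \<omega>] by (cases "w \<omega> = 0") (auto simp: powr_diff)
    then have "x * w \<omega> powr (x - 1) * w \<omega> + (1 - x) * w \<omega> powr x = w \<omega> powr x"
      by (simp add: algebra_simps)
    then show "ennreal (x * w \<omega> powr (x - 1)) * ennreal (w \<omega>) + ennreal ((1 - x) * w \<omega> powr x)
      = ennreal (w \<omega> powr x)"
      using w0[of \<omega>] x
      by (simp add: ennreal_mult'[symmetric] ennreal_plus[symmetric] del: ennreal_plus)
  qed
  also have "\<dots> = (\<integral>\<^sup>+\<omega>. ennreal (w \<omega> powr x) \<partial>M)"
    unfolding M_def by (rule nn_integral_subalgebra2[OF sub, symmetric]) measurable
  also have "\<dots> = hellinger_integral x N M"
    by (simp add: hellinger_integral_def w_def)
  finally show ?thesis by (simp add: M_def N_def)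
qed

section \<open>Upper bounds from splitting the space\<close>

text \<open>The tangent inequality is integrated with the constant \<open>s\<close> off
  \<open>A\<close> and \<open>t\<close> on \<open>A\<close>, and the absolutely continuous part is
  bounded by \<open>N\<close>. The result involves only measures of sets, which restriction to a
  subalgebra leaves unchanged.\<close>

lemma hellinger_integral_le_split:
  assumes "finite_measure M" "finite_measure N" "sets M = sets N" "A \<in> sets M"
    and x: "0 < x" "x < 1" and "0 < s" "0 < t"
  shows "hellinger_integral x N M \<le>
    ennreal (x * s powr (x - 1) * measure N (space M - A) + (1 - x) * s powr x * measure M (space M - A)
      + (x * t powr (x - 1) * measure N A + (1 - x) * t powr x * measure M A))"
proof -
  interpret M: finite_measure M by fact
  interpret N: finite_measure N by fact
  define w where "w = (\<lambda>\<omega>. enn2real (ac_density M N \<omega>))"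
  have w[measurable]: "w \<in> borel_measurable M" and w0: "\<And>\<omega>. 0 \<le> w \<omega>" by (simp_all add: w_def)
  have acM: "ac_part M N = density M (\<lambda>\<omega>. ennreal (w \<omega>))"
    unfolding w_def using assms by (intro ac_part_density) auto
  have part: "(\<integral>\<^sup>+\<omega>. ennreal (w \<omega> powr x) * indicator B \<omega> \<partial>M) \<le>
      ennreal (x * r powr (x - 1) * measure N B + (1 - x) * r powr x * measure M B)"
    if B[measurable]: "B \<in> sets M" and r: "0 < r" for B r
  proof -
    have "(\<integral>\<^sup>+\<omega>. ennreal (w \<omega> powr x) * indicator B \<omega> \<partial>M) \<le>
      (\<integral>\<^sup>+\<omega>. ennreal (x * r powr (x - 1)) * (ennreal (w \<omega>) * indicator B \<omega>)
           + ennreal ((1 - x) * r powr x) * indicator B \<omega> \<partial>M)"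
    proof (rule nn_integral_mono)
      fix \<omega>
      show "ennreal (w \<omega> powr x) * indicator B \<omega> \<le>
        ennreal (x * r powr (x - 1)) * (ennreal (w \<omega>) * indicator B \<omega>)
           + ennreal ((1 - x) * r powr x) * indicator B \<omega>"
        using powr_le_tangent[OF w0[of \<omega>] r x] w0[of \<omega>] x
        by (simp add: indicator_def ennreal_mult'[symmetric] ennreal_plus[symmetric] del: ennreal_plus)
    qed
    also have "\<dots> = ennreal (x * r powr (x - 1)) * (\<integral>\<^sup>+\<omega>. ennreal (w \<omega>) * indicator B \<omega> \<partial>M)
        + ennreal ((1 - x) * r powr x) * emeasure M B"
      by (simp add: nn_integral_add nn_integral_cmult)
    also have "(\<integral>\<^sup>+\<omega>. ennreal (w \<omega>) * indicator B \<omega> \<partial>M) = emeasure (ac_part M N) B"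
      unfolding acM by (simp add: emeasure_density)
    also have "ennreal (x * r powr (x - 1)) * emeasure (ac_part M N) B
        + ennreal ((1 - x) * r powr x) * emeasure M B
      \<le> ennreal (x * r powr (x - 1)) * emeasure N B + ennreal ((1 - x) * r powr x) * emeasure M B"
      using assms B by (intro add_right_mono mult_left_mono ac_part_le) auto
    also have "\<dots> = ennreal (x * r powr (x - 1) * measure N B + (1 - x) * r powr x * measure M B)"
      using x by (simp add: N.emeasure_eq_measure M.emeasure_eq_measure ennreal_mult''[symmetric])
    finally show ?thesis .
  qed
  have A[measurable]: "A \<in> sets M" by fact
  have "hellinger_integral x N M = (\<integral>\<^sup>+\<omega>. ennreal (w \<omega> powr x) \<partial>M)"
    by (simp add: hellinger_integral_def w_def)
  also have "\<dots> = (\<integral>\<^sup>+\<omega>. ennreal (w \<omega> powr x) * indicator (space M - A) \<omega>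
                  + ennreal (w \<omega> powr x) * indicator A \<omega> \<partial>M)"
    by (intro nn_integral_cong) (auto simp: indicator_def)
  also have "\<dots> = (\<integral>\<^sup>+\<omega>. ennreal (w \<omega> powr x) * indicator (space M - A) \<omega> \<partial>M)
                  + (\<integral>\<^sup>+\<omega>. ennreal (w \<omega> powr x) * indicator A \<omega> \<partial>M)"
    by (rule nn_integral_add) measurable
  also have "\<dots> \<le> ennreal (x * s powr (x - 1) * measure N (space M - A)
        + (1 - x) * s powr x * measure M (space M - A))
      + ennreal (x * t powr (x - 1) * measure N A + (1 - x) * t powr x * measure M A)"
    using assms by (intro add_mono part) auto
  also have "\<dots> = ennreal (x * s powr (x - 1) * measure N (space M - A)
        + (1 - x) * s powr x * measure M (space M - A)
      + (x * t powr (x - 1) * measure N A + (1 - x) * t powr x * measure M A))"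
    using x by (intro ennreal_plus[symmetric]) auto
  finally show ?thesis .
qed

section \<open>Approximation by sets of a generating algebra\<close>

text \<open>The sets that can be approximated to every precision form a \<sigma>-algebra containing
  \<open>G\<close>. Both measures are handled in one induction because a single \<open>A\<close> has
  to serve them simultaneously.\<close>

lemma sigma_sets_approx_by_algebra:
  assumes "finite_measure M" "finite_measure N" "algebra \<Omega> G"
    and M: "sets M = sigma_sets \<Omega> G" and N: "sets N = sigma_sets \<Omega> G"
    and S: "S \<in> sigma_sets \<Omega> G" and "0 < e"
  shows "\<exists>A\<in>G. measure M (sym_diff S A) < e \<and> measure N (sym_diff S A) < e"
  using S \<open>0 < e\<close>
proof (induction arbitrary: e rule: sigma_sets.induct)
  case (Basic a)
  then show ?case by (intro bexI[of _ a]) auto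
next
  case Empty
  interpret algebra \<Omega> G by fact
  show ?case using Empty by (intro bexI[of _ "{}"]) auto
next
  case (Compl a)
  interpret algebra \<Omega> G by fact
  obtain A where A: "A \<in> G" "measure M (sym_diff a A) < e" "measure N (sym_diff a A) < e"
    using Compl by blast
  have "a \<subseteq> \<Omega>" using Compl.hyps sigma_sets_into_sp[OF space_closed] by blast
  then have "sym_diff (\<Omega> - a) (\<Omega> - A) = sym_diff a A"
    using A(1) sets_into_space by blast
  then show ?case using A by (intro bexI[of _ "\<Omega> - A"]) auto
next
  case (Union a)
  interpret algebra \<Omega> G by fact
  interpret M: finite_measure M by fact
  interpret N: finite_measure N by fact
  define U where "U n = (\<Union>i<n. a i)" for n :: nat
  have aM: "a i \<in> sets M" and aN: "a i \<in> sets N" for i using Union.hyps M N by auto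
  have UU: "(\<Union>n. U n) = (\<Union>i. a i)" by (auto simp: U_def)
  have inc: "incseq U" by (auto simp: U_def incseq_def intro: less_le_trans)
  have UM: "range U \<subseteq> sets M" and UN: "range U \<subseteq> sets N"
    using aM aN by (auto simp: U_def)
  have lim: "(\<lambda>n. measure M (U n)) \<longlonglongrightarrow> measure M (\<Union>i. a i)"
    "(\<lambda>n. measure N (U n)) \<longlonglongrightarrow> measure N (\<Union>i. a i)"
    using M.finite_Lim_measure_incseq[OF UM inc] N.finite_Lim_measure_incseq[OF UN inc]
    by (simp_all add: UU)
  have "\<forall>\<^sub>F n in sequentially. measure M (\<Union>i. a i) - e/2 < measure M (U n)
      \<and> measure N (\<Union>i. a i) - e/2 < measure N (U n)"
    using Union.prems by (intro eventually_conj order_tendstoD(1)[OF lim(1)] order_tendstoD(1)[OF lim(2)]) auto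
  then obtain n where n: "measure M (\<Union>i. a i) - e/2 < measure M (U n)"
    "measure N (\<Union>i. a i) - e/2 < measure N (U n)"
    using eventually_happens' sequentially_bot by blast
  \<comment> \<open>The \<open>n\<close> errors below \<open>d\<close> add up to at most
    \<open>e / 2\<close>; the other half pays for the tail of the union beyond \<open>U n\<close>.
    Adding 1 keeps the denominator positive when \<open>n = 0\<close>.\<close>
  define d where "d = e / (2 * (real n + 1))"
  have d: "0 < d" using Union.prems by (simp add: d_def)
  have "\<forall>i. \<exists>A\<in>G. measure M (sym_diff (a i) A) < d \<and> measure N (sym_diff (a i) A) < d"
    using Union.IH d by blast
  then obtain B where B: "\<And>i. B i \<in> G" "\<And>i. measure M (sym_diff (a i) (B i)) < d"
    "\<And>i. measure N (sym_diff (a i) (B i)) < d" by metis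
  define A where "A = (\<Union>i<n. B i)"
  have AG: "A \<in> G" unfolding A_def using B(1) by (intro finite_UN) auto
  have main: "measure K (sym_diff (\<Union>i. a i) A) < e"
    if "finite_measure K" and K: "sets K = sigma_sets \<Omega> G"
      and Kn: "measure K (\<Union>i. a i) - e/2 < measure K (U n)"
      and KB: "\<And>i. measure K (sym_diff (a i) (B i)) < d" for K
  proof -
    interpret K: finite_measure K by fact
    have aK: "a i \<in> sets K" "B i \<in> sets K" for i using Union.hyps K B(1) by auto
    have UK: "U n \<in> sets K" using aK by (auto simp: U_def)
    have Ua: "U n \<subseteq> (\<Union>i. a i)" by (auto simp: U_def)
    have sK: "(\<Union>i. a i) \<in> sets K" "(\<Union>i<n. sym_diff (a i) (B i)) \<in> sets K" using aK by auto
    have "measure K (sym_diff (\<Union>i. a i) A) \<le>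
        measure K (((\<Union>i. a i) - U n) \<union> (\<Union>i<n. sym_diff (a i) (B i)))"
      using sK UK by (intro K.finite_measure_mono) (auto simp: A_def U_def)
    also have "\<dots> \<le> measure K ((\<Union>i. a i) - U n) + measure K (\<Union>i<n. sym_diff (a i) (B i))"
      using sK UK by (intro measure_Un_le) auto
    also have "measure K ((\<Union>i. a i) - U n) = measure K (\<Union>i. a i) - measure K (U n)"
      using sK UK Ua by (intro K.finite_measure_Diff) auto
    also have "measure K (\<Union>i<n. sym_diff (a i) (B i)) \<le> (\<Sum>i<n. measure K (sym_diff (a i) (B i)))"
      using aK by (intro K.finite_measure_subadditive_finite) auto
    also have "\<dots> \<le> (\<Sum>i<n. d)" using KB by (intro sum_mono less_imp_le)
    also have "\<dots> \<le> e / 2" using Union.prems by (simp add: d_def field_simps)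
    finally show ?thesis using Kn by simp
  qed
  show ?case
    using AG main[OF assms(1) M n(1) B(2)] main[OF assms(2) N n(2) B(3)] by blast
qed

section \<open>Exponents tending to 1\<close>

text \<open>Powers \<open>z powr p\<close> increase with \<open>p\<close> where \<open>z > 1\<close>
  but decrease where \<open>0 < z < 1\<close>. Capping them by \<open>z\<close> repairs
  monotonicity: \<open>min z (z powr p)\<close> increases to \<open>z\<close>, and it lies below
  \<open>z powr q\<close> for all \<open>q\<close> in \<open>[p, 1]\<close>, so it also bounds the
  infimum over exponents.\<close>

lemma SUP_hellinger_integral_ge:
  assumes "finite_measure \<mu>" "finite_measure \<nu>" "sets \<nu> = sets \<mu>"
  shows "emeasure (ac_part \<nu> \<mu>) (space \<nu>) \<le>
    (SUP \<beta>\<in>{0<..<1}. INF x\<in>{\<beta>..<1}. hellinger_integral x \<mu> \<nu>)"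
proof -
  define z where "z = (\<lambda>\<omega>. enn2real (ac_density \<nu> \<mu> \<omega>))"
  have z[measurable]: "z \<in> borel_measurable \<nu>" and z0: "\<And>\<omega>. 0 \<le> z \<omega>" by (simp_all add: z_def)
  \<comment> \<open>The shift by 2 makes \<open>\<beta> 0 = 1/2\<close>, so that every term lies
    strictly between 0 and 1.\<close>
  define \<beta> where "\<beta> k = 1 - 1 / (real k + 2)" for k :: nat
  define f where "f k \<omega> = ennreal (min (z \<omega>) (z \<omega> powr \<beta> k))" for k \<omega>
  have \<beta>: "\<beta> k \<in> {0<..<1}" for k by (simp add: \<beta>_def)
  have \<beta>_mono: "\<beta> j \<le> \<beta> k" if "j \<le> k" for j k
    using that by (simp add: \<beta>_def field_simps)
  have pm: "min (z \<omega>) (z \<omega> powr p) \<le> z \<omega> powr q" if "0 < p" "p \<le> q" "q \<le> 1" for p q \<omega>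
  proof (cases "z \<omega> \<le> 1")
    case True
    have "z \<omega> powr 1 \<le> z \<omega> powr q"
      using True z0[of \<omega>] that by (intro powr_mono') auto
    then show ?thesis using z0[of \<omega>] by simp
  next
    case False
    then have "z \<omega> powr p \<le> z \<omega> powr q" using that by (intro powr_mono) auto
    then show ?thesis by simp
  qed
  have "incseq f"
    unfolding incseq_def le_fun_def f_def
  proof (intro allI impI ennreal_leI min.boundedI)
    fix j k \<omega> assume "j \<le> (k :: nat)"
    then show "min (z \<omega>) (z \<omega> powr \<beta> j) \<le> z \<omega> powr \<beta> k"
      using \<beta>[of j] \<beta>[of k] \<beta>_mono by (intro pm) auto
  qed simp
  have sup: "(SUP k. f k \<omega>) = ennreal (z \<omega>)" for \<omega>
  proof (rule LIMSEQ_unique)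
    show "(\<lambda>k. f k \<omega>) \<longlonglongrightarrow> (SUP k. f k \<omega>)"
      using \<open>incseq f\<close> by (intro LIMSEQ_SUP) (auto simp: incseq_def le_fun_def)
    have "\<beta> \<longlonglongrightarrow> 1" unfolding \<beta>_def by real_asymp
    then have "(\<lambda>k. min (z \<omega>) (z \<omega> powr \<beta> k)) \<longlonglongrightarrow> min (z \<omega>) (z \<omega> powr 1)"
      \<comment> \<open>Continuity of \<open>powr\<close> is invoked at a nonzero base; for base 0
        the sequence is constantly 0.\<close>
      by (cases "z \<omega> = 0") (auto intro!: tendsto_min tendsto_powr simp del: powr_one powr_one')
    then show "(\<lambda>k. f k \<omega>) \<longlonglongrightarrow> ennreal (z \<omega>)"
      unfolding f_def using z0[of \<omega>] by (intro tendsto_ennrealI) simp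
  qed
  have "emeasure (ac_part \<nu> \<mu>) (space \<nu>) = (\<integral>\<^sup>+\<omega>. ennreal (z \<omega>) \<partial>\<nu>)"
    unfolding ac_part_density[OF assms(2,1,3)]
    by (subst emeasure_density) (auto intro!: nn_integral_cong simp: z_def)
  also have "\<dots> = (SUP k. \<integral>\<^sup>+\<omega>. f k \<omega> \<partial>\<nu>)"
    unfolding sup[symmetric] using \<open>incseq f\<close>
    by (rule nn_integral_monotone_convergence_SUP) (simp add: f_def[abs_def])
  also have "\<dots> \<le> (SUP \<beta>\<in>{0<..<1}. INF x\<in>{\<beta>..<1}. hellinger_integral x \<mu> \<nu>)"
  proof (rule SUP_least)
    fix k
    have "(\<integral>\<^sup>+\<omega>. f k \<omega> \<partial>\<nu>) \<le> (INF x\<in>{\<beta> k..<1}. hellinger_integral x \<mu> \<nu>)"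
      unfolding hellinger_integral_def f_def
      using pm[unfolded z_def] \<beta>[of k]
      by (intro INF_greatest nn_integral_mono ennreal_leI) (auto simp: z_def)
    also have "\<dots> \<le> (SUP \<beta>\<in>{0<..<1}. INF x\<in>{\<beta>..<1}. hellinger_integral x \<mu> \<nu>)"
      using \<beta>[of k] by (rule SUP_upper)
    finally show "(\<integral>\<^sup>+\<omega>. f k \<omega> \<partial>\<nu>) \<le> (SUP \<beta>\<in>{0<..<1}. INF x\<in>{\<beta>..<1}. hellinger_integral x \<mu> \<nu>)" .
  qed
  finally show ?thesis .
qed

section \<open>The double lower limit along a filtration\<close>

theorem proposition2:
  fixes \<Omega> :: "'a set" and F :: "nat \<Rightarrow> 'a measure" and \<mu> \<nu> :: "'a measure"
  assumes "filtration \<Omega> F"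
    and "prob_space \<mu>" and "sets \<mu> = sets (sigma \<Omega> (\<Union>n. sets (F n)))"
    and "prob_space \<nu>" and "sets \<nu> = sets (sigma \<Omega> (\<Union>n. sets (F n)))"
  shows "total_variation_norm \<nu> (measure (ac_part \<nu> \<mu>)) =
    double_liminf (\<lambda>\<alpha> n. hellinger_integral \<alpha> (restr_to_subalg \<mu> (F n)) (restr_to_subalg \<nu> (F n)))"
proof -
  interpret F: filtration \<Omega> F by fact
  interpret \<mu>: prob_space \<mu> by fact
  interpret \<nu>: prob_space \<nu> by fact
  define G where "G = (\<Union>n. sets (F n))"
  have GP: "G \<subseteq> Pow \<Omega>" unfolding G_def using F.space_F sets.space_closed by blast
  have sets\<mu>: "sets \<mu> = sigma_sets \<Omega> G" and sets\<nu>: "sets \<nu> = sigma_sets \<Omega> G"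
    using assms GP by (simp_all add: G_def[symmetric])
  have sets_eq: "sets \<nu> = sets \<mu>" by (simp add: sets\<mu> sets\<nu>)
  have sp\<mu>: "space \<mu> = \<Omega>"
    using sets_eq_imp_space_eq[OF assms(3)] GP by (simp add: G_def[symmetric] space_measure_of_conv)
  have sp\<nu>: "space \<nu> = \<Omega>" using sets_eq_imp_space_eq[OF sets_eq] sp\<mu> by simp
  have sub\<mu>: "subalgebra \<mu> (F n)" and sub\<nu>: "subalgebra \<nu> (F n)" for n
    unfolding subalgebra_def sp\<mu> sp\<nu> sets\<mu> sets\<nu> F.space_F by (auto simp: G_def)
  \<comment> \<open>A union of increasing \<sigma>-algebras need not be a \<sigma>-algebra, but two
    of its members always lie in a common \<open>F (max i j)\<close>.\<close>
  have alg: "algebra \<Omega> G"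
    unfolding algebra_iff_Un
  proof (intro conjI ballI)
    show "G \<subseteq> Pow \<Omega>" by fact
    show "{} \<in> G" by (auto simp: G_def)
    fix a assume "a \<in> G"
    then obtain i where i: "a \<in> sets (F i)" by (auto simp: G_def)
    then have "\<Omega> - a \<in> sets (F i)" using F.space_F[of i] sets.compl_sets by metis
    then show "\<Omega> - a \<in> G" by (auto simp: G_def)
    fix b assume "b \<in> G"
    then obtain j where j: "b \<in> sets (F j)" by (auto simp: G_def)
    have "a \<in> sets (F (max i j))" "b \<in> sets (F (max i j))"
      using i j F.sets_F_mono[of i "max i j"] F.sets_F_mono[of j "max i j"] by auto
    then show "a \<union> b \<in> G" by (auto simp: G_def)
  qed
  have finac: "finite_measure (ac_part \<nu> \<mu>)" and setsac: "sets (ac_part \<nu> \<mu>) = sets \<nu>"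
  proof -
    show s: "sets (ac_part \<nu> \<mu>) = sets \<nu>"
      by (subst ac_part_density) (use sets_eq in \<open>auto intro: \<mu>.finite_measure_axioms \<nu>.finite_measure_axioms\<close>)
    have "emeasure (ac_part \<nu> \<mu>) \<Omega> \<le> emeasure \<mu> \<Omega>"
      using sets_eq sp\<mu> by (intro ac_part_le \<mu>.finite_measure_axioms) auto
    then show "finite_measure (ac_part \<nu> \<mu>)"
      using sets_eq_imp_space_eq[OF s] \<mu>.emeasure_finite[of \<Omega>]
      by (intro finite_measureI) (auto simp: sp\<nu> top_unique)
  qed
  define H where "H = (\<lambda>\<alpha> n. hellinger_integral \<alpha> (restr_to_subalg \<mu> (F n)) (restr_to_subalg \<nu> (F n)))"
  define c where "c = measure (ac_part \<nu> \<mu>) \<Omega>"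
  have tv: "total_variation_norm \<nu> (measure (ac_part \<nu> \<mu>)) = emeasure (ac_part \<nu> \<mu>) (space \<nu>)"
    using finac setsac by (intro total_variation_norm_measure) auto
  have ce: "emeasure (ac_part \<nu> \<mu>) (space \<nu>) = ennreal c"
    unfolding c_def sp\<nu> using finac by (rule finite_measure.emeasure_eq_measure)
  have "ennreal c \<le> double_liminf H"
  proof -
    have "ennreal c \<le> (SUP \<beta>\<in>{0<..<1}. INF x\<in>{\<beta>..<1}. hellinger_integral x \<mu> \<nu>)"
      unfolding ce[symmetric]
      by (rule SUP_hellinger_integral_ge[OF \<mu>.finite_measure_axioms \<nu>.finite_measure_axioms sets_eq])
    also have "\<dots> \<le> double_liminf H"
    proof (rule SUP_least)
      fix \<beta> :: real assume \<beta>: "\<beta> \<in> {0<..<1}"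
      \<comment> \<open>The bound by the unrestricted Hellinger integral is uniform in time, so the
        starting index 0 suffices.\<close>
      have "(INF x\<in>{\<beta>..<1}. hellinger_integral x \<mu> \<nu>) \<le> (INF (m, x)\<in>{0..} \<times> {\<beta>..<1}. H x m)"
      proof (rule INF_greatest, clarify)
        fix m :: nat and x :: real assume x: "x \<in> {\<beta>..<1}"
        have "(INF x\<in>{\<beta>..<1}. hellinger_integral x \<mu> \<nu>) \<le> hellinger_integral x \<mu> \<nu>"
          using x by (rule INF_lower)
        also have "\<dots> \<le> H x m"
          unfolding H_def using x \<beta>
          by (intro hellinger_integral_restr_ge sets_eq sub\<nu> \<mu>.finite_measure_axioms \<nu>.finite_measure_axioms) auto
        finally show "(INF x\<in>{\<beta>..<1}. hellinger_integral x \<mu> \<nu>) \<le> H x m" .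
      qed
      also have "\<dots> \<le> double_liminf H"
        unfolding double_liminf_def using \<beta> by (intro SUP_upper2[of "(0, \<beta>)"]) auto
      finally show "(INF x\<in>{\<beta>..<1}. hellinger_integral x \<mu> \<nu>) \<le> double_liminf H" .
    qed
    finally show ?thesis .
  qed
  moreover have "double_liminf H \<le> ennreal c"
    unfolding double_liminf_def
  proof (rule SUP_least, clarify)
    fix n :: nat and \<beta> :: real assume \<beta>: "\<beta> \<in> {0<..<1}"
    obtain S where S: "S \<in> null_sets \<nu>"
      "\<And>A. A \<in> sets \<mu> \<Longrightarrow> emeasure \<mu> (A - S) = emeasure (ac_part \<nu> \<mu>) (A - S)"
      using ac_part_carrier[OF \<mu>.finite_measure_axioms sets_eq] by blast
    have S\<mu>: "S \<in> sets \<mu>" "S \<in> sets \<nu>" using S(1) sets_eq by auto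
    \<comment> \<open>Off the carrier of its singular part, \<open>\<mu>\<close> has mass at most
      \<open>c\<close>.\<close>
    have "measure \<mu> (\<Omega> - S) = measure (ac_part \<nu> \<mu>) (\<Omega> - S)"
      using S(2)[of \<Omega>] sp\<mu> by (metis measure_def sets.top)
    also have "\<dots> \<le> c"
      unfolding c_def using S\<mu> setsac sets.top[of \<nu>] sp\<nu>
      by (intro finite_measure.finite_measure_mono[OF finac]) auto
    finally have Sc: "measure \<mu> (\<Omega> - S) \<le> c" .
    show "(INF (m, x)\<in>{n..} \<times> {\<beta>..<1}. H x m) \<le> ennreal c"
    proof (rule ennreal_le_epsilon)
      fix \<delta> :: real assume \<delta>: "0 < \<delta>"
      \<comment> \<open>For each \<open>n\<close> and \<open>\<beta>\<close> one admissible pair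
        \<open>(m, x)\<close> with value at most \<open>c + \<delta>\<close> is enough. The choices
        are made in the order \<open>x\<close>, \<open>T\<close>, \<open>e\<close>,
        \<open>A\<close>, \<open>m\<close>, giving each of four error terms a share
        \<open>\<delta> / 4\<close>: \<open>x\<close> near 1 controls the constant term off
        \<open>A\<close>, \<open>T\<close> the linear term on \<open>A\<close>, and \<open>e\<close>
        both the loss of \<open>\<mu>\<close> off \<open>A\<close> and the term
        \<open>T powr x * measure \<nu> A\<close>.\<close>
      define x where "x = max \<beta> (1 - \<delta> / 4)"
      have x: "x \<in> {\<beta>..<1}" "0 < x" "x < 1" "1 - x \<le> \<delta> / 4" using \<beta> \<delta> by (auto simp: x_def max_def)
      define T where "T = (\<delta> / 4) powr (1 / (x - 1))"
      have T: "0 < T" "T powr (x - 1) = \<delta> / 4" using \<delta> x by (auto simp: T_def powr_powr)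
      define e where "e = min (\<delta> / 4) (\<delta> / 4 / T powr x)"
      have e: "0 < e" using \<delta> T by (simp add: e_def)
      have eT: "T powr x * e \<le> \<delta> / 4"
        using mult_left_mono[of e "\<delta> / 4 / T powr x" "T powr x"] T(1) by (simp add: e_def)
      obtain A where A: "A \<in> G" "measure \<mu> (sym_diff S A) < e" "measure \<nu> (sym_diff S A) < e"
        using sigma_sets_approx_by_algebra[OF \<mu>.finite_measure_axioms \<nu>.finite_measure_axioms alg sets\<mu> sets\<nu> _ e, of S]
          S\<mu> sets\<mu> by blast
      have As: "A \<in> sets \<mu>" "A \<in> sets \<nu>" using A(1) by (auto simp: sets\<mu> sets\<nu>)
      from A(1) obtain k where "A \<in> sets (F k)" by (auto simp: G_def)
      then have Am: "A \<in> sets (F (max n k))" using F.sets_F_mono[of k "max n k"] by auto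
      \<comment> \<open>Late enough for \<open>A\<close> to be observable, and at least
        \<open>n\<close> so that the infimum includes it.\<close>
      define m where "m = max n k"
      have setsm: "sets (restr_to_subalg \<mu> (F m)) = sets (F m)" "sets (restr_to_subalg \<nu> (F m)) = sets (F m)"
        using sub\<mu> sub\<nu> by (simp_all add: sets_restr_to_subalg)
      have meas: "measure (restr_to_subalg \<mu> (F m)) B = measure \<mu> B"
        "measure (restr_to_subalg \<nu> (F m)) B = measure \<nu> B" if "B \<in> sets (F m)" for B
        using emeasure_restr_to_subalg[OF sub\<mu> that] emeasure_restr_to_subalg[OF sub\<nu> that]
        by (simp_all add: measure_def)
      have Ac: "\<Omega> - A \<in> sets (F m)" "A \<in> sets (F m)"
        using Am F.space_F[of m] sets.compl_sets[of A "F m"] by (auto simp: m_def)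
      have "H x m \<le> ennreal (x * 1 powr (x - 1) * measure \<mu> (\<Omega> - A) + (1 - x) * 1 powr x * measure \<nu> (\<Omega> - A)
          + (x * T powr (x - 1) * measure \<mu> A + (1 - x) * T powr x * measure \<nu> A))"
        using hellinger_integral_le_split[of "restr_to_subalg \<nu> (F m)" "restr_to_subalg \<mu> (F m)" A x 1 T]
          x(2,3) T(1) Ac setsm finite_measure_restr_to_subalg[OF sub\<mu> \<mu>.finite_measure_axioms, of m]
          finite_measure_restr_to_subalg[OF sub\<nu> \<nu>.finite_measure_axioms, of m]
        by (simp add: H_def space_restr_to_subalg sp\<nu> meas)
      also have "\<dots> \<le> ennreal (c + \<delta>)"
      proof (rule ennreal_leI)
        have "measure \<mu> (\<Omega> - A) \<le> measure \<mu> ((\<Omega> - S) \<union> sym_diff S A)"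
          using As S\<mu> sets.top[of \<mu>] sp\<mu> by (intro \<mu>.finite_measure_mono) auto
        also have "\<dots> \<le> measure \<mu> (\<Omega> - S) + measure \<mu> (sym_diff S A)"
          using As S\<mu> sets.top[of \<mu>] sp\<mu> by (intro measure_Un_le) auto
        also have "\<dots> \<le> c + \<delta> / 4" using Sc A(2) by (simp add: e_def)
        finally have 1: "measure \<mu> (\<Omega> - A) \<le> c + \<delta> / 4" .
        have "x * measure \<mu> (\<Omega> - A) \<le> 1 * measure \<mu> (\<Omega> - A)"
          using x by (intro mult_right_mono) auto
        then have t1: "x * 1 powr (x - 1) * measure \<mu> (\<Omega> - A) \<le> c + \<delta> / 4" using 1 by simp
        have "(1 - x) * measure \<nu> (\<Omega> - A) \<le> (1 - x) * 1"
          using x by (intro mult_left_mono) auto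
        then have t2: "(1 - x) * 1 powr x * measure \<nu> (\<Omega> - A) \<le> \<delta> / 4"
          unfolding powr_one_eq_one mult_1_right using x(4) by linarith
        have "x * measure \<mu> A \<le> 1 * 1" using x by (intro mult_mono) auto
        then have "\<delta> / 4 * (x * measure \<mu> A) \<le> \<delta> / 4 * 1" using \<delta> by (intro mult_left_mono) auto
        then have t3: "x * T powr (x - 1) * measure \<mu> A \<le> \<delta> / 4"
          unfolding T(2) mult_1_right by (simp only: mult_ac)
        \<comment> \<open>As \<open>S\<close> is \<open>\<nu>\<close>-null, \<open>A\<close> has
          only the \<open>\<nu>\<close>-mass of the approximation error.\<close>
        have "measure \<nu> A \<le> measure \<nu> (S \<union> sym_diff S A)"
          using As S\<mu> by (intro \<nu>.finite_measure_mono) auto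
        also have "\<dots> \<le> measure \<nu> S + measure \<nu> (sym_diff S A)"
          using As S\<mu> by (intro measure_Un_le) auto
        also have "\<dots> \<le> e" using A(3) null_setsD1[OF S(1)] by (simp add: measure_eq_emeasure_eq_ennreal[of 0])
        finally have 4: "measure \<nu> A \<le> e" .
        have "(1 - x) * (T powr x * measure \<nu> A) \<le> 1 * (T powr x * e)"
          using x 4 e by (intro mult_mono mult_left_mono) auto
        then have t4: "(1 - x) * T powr x * measure \<nu> A \<le> \<delta> / 4" using eT by (simp add: mult_ac)
        show "x * 1 powr (x - 1) * measure \<mu> (\<Omega> - A) + (1 - x) * 1 powr x * measure \<nu> (\<Omega> - A)
          + (x * T powr (x - 1) * measure \<mu> A + (1 - x) * T powr x * measure \<nu> A) \<le> c + \<delta>"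
          using t1 t2 t3 t4 by linarith
      qed
      also have "\<dots> = ennreal c + ennreal \<delta>" using \<delta> by (simp add: c_def)
      finally have "H x m \<le> ennreal c + ennreal \<delta>" .
      moreover have "(INF (m, x)\<in>{n..} \<times> {\<beta>..<1}. H x m) \<le> H x m"
        using x by (intro INF_lower2[of "(m, x)"]) (auto simp: m_def)
      ultimately show "(INF (m, x)\<in>{n..} \<times> {\<beta>..<1}. H x m) \<le> ennreal c + ennreal \<delta>" by simp
    qed
  qed
  ultimately show ?thesis unfolding tv ce H_def[symmetric] by (rule antisym)
qed

end
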